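(* Given a sample $\mathcal S$, the decision-tree-based learning algorithm learns a (not necessarily minimal) LTL formula $\psi_t$ that is consistent with $\mathcal S$.
   Context: Let $\mathcal P$ be a finite nonempty set of atomic propositions. LTL formulas are built from atomic propositions $p \in \mathcal P$ using $\lnot$, $\lor$, the temporal operators $\mathbf{X}$ ("next") and $\mathbf{U}$ ("until"), with derived operators $\land$, $\rightarrow$, $\mathbf{F}\psi \coloneqq \mathit{true}\,\mathbf{U}\,\psi$ ("finally") and $\mathbf{G}\psi \coloneqq \lnot\mathbf{F}\lnot\psi$ ("globally"); they are interpreted over infinite words in $(2^{\mathcal P})^\omega$ with the standard semantics, and $V(\varphi,\alpha)\in\{0,1\}$ denotes the truth value of $\varphi$ on word $\alpha$. A sample $\mathcal S=(P,N)$ consists of two finite disjoint sets $P,N$ of ultimately periodic words $uv^\omega$, the positive and negative examples; an LTL formula $\varphi$ is consistent with $\mathcal S$ if $V(\varphi,\alpha)=1$ for all $\alpha\in P$ and $V(\varphi,\beta)=0$ for all $\beta\in N$. The decision-tree-based algorithm proceeds in two phases: (1) it repeatedly runs a SAT-based learner (which returns a minimal-size LTL formula consistent with a given sample) on small subsets of $P$ and $N$, collecting the resulting formulas into a set $\Pi=\{\varphi_1,\dots,\varphi_m\}$ of "LTL primitives" until for every pair $\alpha\in P$, $\beta\in N$ there is some $\varphi_i\in\Pi$ with $V(\varphi_i,\alpha)=1$ and $V(\varphi_i,\beta)=0$; (2) it maps each example to the Boolean feature vector $(V(\varphi_1,\cdot),\dots,V(\varphi_m,\cdot))$ labeled true for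 $P$ and false for $N$, learns a decision tree $t$ classifying all these vectors correctly (standard decision-tree learning, no pruning), and returns $\psi_t \coloneqq \bigvee_{\rho}\bigwedge_{\varphi\in\rho}\varphi$, where $\rho$ ranges over root-to-leaf paths ending in a leaf labeled true and each primitive on $\rho$ appears negated when the path takes its "false" branch.
   Formalization: Consistency is shown for every run that returns a formula; that the algorithm does return one is shown when every pair of a positive and a negative example is eventually among the selected subsets, since otherwise (e.g. only empty subsets) the first phase may run forever. *)

theory Defs
  imports
    "HOL-Library.Omega_Words_Fun"
    "HOL-Library.Multiset"
    "HOL-Library.While_Combinator"
begin

section \<open>Linear temporal logic\<close>

text \<open>The atomic propositions are the elements of a type, which is nonempty; it is
  constrained to class \<open>finite\<close> where this is required.\<close>

datatype 'p ltl =
    Prop 'p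
  | Neg "'p ltl"
  | Or "'p ltl" "'p ltl"
  | Next "'p ltl"
  | Until "'p ltl" "'p ltl"

text \<open>Derived operators. As \<open>true\<close> is not primitive, it is \<open>p \<or> \<not> p\<close> for some
  fixed, but unspecified, atomic proposition.\<close>

definition TrueF :: "'p ltl" where
  "TrueF = (let p = (SOME p. True) in Or (Prop p) (Neg (Prop p)))"

definition FalseF :: "'p ltl" where
  "FalseF = Neg TrueF"

definition And :: "'p ltl \<Rightarrow> 'p ltl \<Rightarrow> 'p ltl" where
  "And \<phi> \<psi> = Neg (Or (Neg \<phi>) (Neg \<psi>))"

definition Implies :: "'p ltl \<Rightarrow> 'p ltl \<Rightarrow> 'p ltl" where
  "Implies \<phi> \<psi> = Or (Neg \<phi>) \<psi>"

definition Finally :: "'p ltl \<Rightarrow> 'p ltl" where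
  "Finally \<psi> = Until TrueF \<psi>"

definition Globally :: "'p ltl \<Rightarrow> 'p ltl" where
  "Globally \<psi> = Neg (Finally (Neg \<psi>))"

fun BigOr :: "'p ltl list \<Rightarrow> 'p ltl" where
  "BigOr [] = FalseF"
| "BigOr [\<phi>] = \<phi>"
| "BigOr (\<phi> # \<phi>s) = Or \<phi> (BigOr \<phi>s)"

fun BigAnd :: "'p ltl list \<Rightarrow> 'p ltl" where
  "BigAnd [] = TrueF"
| "BigAnd [\<phi>] = \<phi>"
| "BigAnd (\<phi> # \<phi>s) = And \<phi> (BigAnd \<phi>s)"

text \<open>Truth value of a formula on an infinite word, with \<open>bool\<close> in the role of \<open>{0,1}\<close>.\<close>

primrec V :: "'p ltl \<Rightarrow> 'p set word \<Rightarrow> bool" where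
  "V (Prop p) \<alpha> \<longleftrightarrow> p \<in> \<alpha> 0"
| "V (Neg \<phi>) \<alpha> \<longleftrightarrow> \<not> V \<phi> \<alpha>"
| "V (Or \<phi> \<psi>) \<alpha> \<longleftrightarrow> V \<phi> \<alpha> \<or> V \<psi> \<alpha>"
| "V (Next \<phi>) \<alpha> \<longleftrightarrow> V \<phi> (suffix 1 \<alpha>)"
| "V (Until \<phi> \<psi>) \<alpha> \<longleftrightarrow> (\<exists>i. V \<psi> (suffix i \<alpha>) \<and> (\<forall>j<i. V \<phi> (suffix j \<alpha>)))"

primrec subformulas :: "'p ltl \<Rightarrow> 'p ltl set" where
  "subformulas (Prop p) = {Prop p}"
| "subformulas (Neg \<phi>) = insert (Neg \<phi>) (subformulas \<phi>)"
| "subformulas (Or \<phi> \<psi>) = insert (Or \<phi> \<psi>) (subformulas \<phi> \<union> subformulas \<psi>)"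
| "subformulas (Next \<phi>) = insert (Next \<phi>) (subformulas \<phi>)"
| "subformulas (Until \<phi> \<psi>) = insert (Until \<phi> \<psi>) (subformulas \<phi> \<union> subformulas \<psi>)"

text \<open>The size of a formula is the number of its distinct subformulas (the size of its
  syntax DAG), not the size of its syntax tree.\<close>

definition ltl_size :: "'p ltl \<Rightarrow> nat" where
  "ltl_size \<phi> = card (subformulas \<phi>)"


section \<open>Samples\<close>

definition ultimately_periodic :: "'a word \<Rightarrow> bool" where
  "ultimately_periodic \<alpha> \<longleftrightarrow> (\<exists>u v. v \<noteq> [] \<and> \<alpha> = u \<frown> v\<^sup>\<omega>)"

type_synonym 'p sample = "'p set word set \<times> 'p set word set"

definition is_sample :: "'p sample \<Rightarrow> bool" where
  "is_sample = (\<lambda>(P, N). finite P \<and> finite N \<and> P \<inter> N = {} \<and>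
     (\<forall>\<alpha> \<in> P \<union> N. ultimately_periodic \<alpha>))"

definition subsample :: "'p sample \<Rightarrow> 'p sample \<Rightarrow> bool" where
  "subsample = (\<lambda>(P', N') (P, N). P' \<subseteq> P \<and> N' \<subseteq> N)"

definition consistent :: "'p ltl \<Rightarrow> 'p sample \<Rightarrow> bool" where
  "consistent \<phi> = (\<lambda>(P, N). (\<forall>\<alpha> \<in> P. V \<phi> \<alpha>) \<and> (\<forall>\<beta> \<in> N. \<not> V \<phi> \<beta>))"

definition minimal_consistent :: "'p ltl \<Rightarrow> 'p sample \<Rightarrow> bool" where
  "minimal_consistent \<phi> S \<longleftrightarrow>
     consistent \<phi> S \<and> (\<forall>\<psi>. consistent \<psi> S \<longrightarrow> ltl_size \<phi> \<le> ltl_size \<psi>)"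

text \<open>The guarantee of the SAT-based learner, which is otherwise arbitrary.\<close>

definition minimal_learner :: "('p sample \<Rightarrow> 'p ltl) \<Rightarrow> bool" where
  "minimal_learner sat \<longleftrightarrow> (\<forall>S. is_sample S \<longrightarrow> minimal_consistent (sat S) S)"


section \<open>Decision trees over Boolean features\<close>

text \<open>\<open>Node i t f\<close> tests feature \<open>i\<close>; \<open>t\<close> is its ``true'' branch and \<open>f\<close> its
  ``false'' branch.\<close>

datatype dtree = Leaf bool | Node nat dtree dtree

primrec classify :: "dtree \<Rightarrow> bool list \<Rightarrow> bool" where
  "classify (Leaf b) x = b"
| "classify (Node i t f) x = (if x ! i then classify t x else classify f x)"

primrec features :: "dtree \<Rightarrow> nat set" where
  "features (Leaf b) = {}"
| "features (Node i t f) = insert i (features t \<union> features f)"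

text \<open>Root-to-leaf paths ending in a leaf labeled \<open>True\<close>; a path is the list of tested
  features, each with the branch taken.\<close>

primrec true_paths :: "dtree \<Rightarrow> (nat \<times> bool) list list" where
  "true_paths (Leaf b) = (if b then [[]] else [])"
| "true_paths (Node i t f) =
     map ((#) (i, True)) (true_paths t) @ map ((#) (i, False)) (true_paths f)"

text \<open>Training data are a multiset of labeled feature vectors, since several examples may
  share a vector and the multiplicities matter to the usual impurity measures.\<close>

type_synonym training_data = "(bool list \<times> bool) multiset"

definition contradictory :: "training_data \<Rightarrow> bool" where
  "contradictory D \<longleftrightarrow> (\<exists>x. (x, True) \<in># D \<and> (x, False) \<in># D)"

text \<open>The guarantee of decision tree learning without pruning, for training data with \<open>m\<close>
  features: the tree classifies the training data correctly unless some vector carries both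
  labels, in which case no tree does and nothing is guaranteed.\<close>

definition tree_learner :: "(nat \<Rightarrow> training_data \<Rightarrow> dtree) \<Rightarrow> bool" where
  "tree_learner dt \<longleftrightarrow>
     (\<forall>m D. (\<forall>(x, b) \<in># D. length x = m) \<and> \<not> contradictory D \<longrightarrow>
        features (dt m D) \<subseteq> {..<m} \<and> (\<forall>(x, b) \<in># D. classify (dt m D) x = b))"


section \<open>The algorithm based on decision trees\<close>

definition separates :: "'p ltl list \<Rightarrow> 'p sample \<Rightarrow> bool" where
  "separates \<Pi> = (\<lambda>(P, N). \<forall>\<alpha> \<in> P. \<forall>\<beta> \<in> N. \<exists>\<phi> \<in> set \<Pi>. V \<phi> \<alpha> \<and> \<not> V \<phi> \<beta>)"

definition add_primitive :: "'p ltl \<Rightarrow> 'p ltl list \<Rightarrow> 'p ltl list" where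
  "add_primitive \<phi> \<Pi> = (if \<phi> \<in> set \<Pi> then \<Pi> else \<Pi> @ [\<phi>])"

text \<open>First phase. The sequence \<open>sel\<close> gives the sub-sample that is selected in each iteration,
  and stands for the outcome of an arbitrary, possibly randomized, selection strategy.
  The list \<open>\<Pi>\<close> enumerates the set of primitives without repetition. The result is \<open>None\<close>
  if the loop does not terminate.\<close>

definition primitives ::
  "('p sample \<Rightarrow> 'p ltl) \<Rightarrow> (nat \<Rightarrow> 'p sample) \<Rightarrow> 'p sample \<Rightarrow> 'p ltl list option" where
  "primitives sat sel S = map_option snd
     (while_option
       (\<lambda>(k, \<Pi>). \<not> separates \<Pi> S)
       (\<lambda>(k, \<Pi>). (Suc k, add_primitive (sat (sel k)) \<Pi>))
       (0, []))"

definition feature_vector :: "'p ltl list \<Rightarrow> 'p set word \<Rightarrow> bool list" where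
  "feature_vector \<Pi> \<alpha> = map (\<lambda>\<phi>. V \<phi> \<alpha>) \<Pi>"

definition training_data :: "'p ltl list \<Rightarrow> 'p sample \<Rightarrow> training_data" where
  "training_data \<Pi> = (\<lambda>(P, N).
     image_mset (\<lambda>\<alpha>. (feature_vector \<Pi> \<alpha>, True)) (mset_set P) +
     image_mset (\<lambda>\<beta>. (feature_vector \<Pi> \<beta>, False)) (mset_set N))"

definition tree_formula :: "'p ltl list \<Rightarrow> dtree \<Rightarrow> 'p ltl" where
  "tree_formula \<Pi> t = BigOr
     (map (\<lambda>\<rho>. BigAnd (map (\<lambda>(i, b). if b then \<Pi> ! i else Neg (\<Pi> ! i)) \<rho>)) (true_paths t))"

definition dt_algorithm ::
  "('p sample \<Rightarrow> 'p ltl) \<Rightarrow> (nat \<Rightarrow> training_data \<Rightarrow> dtree) \<Rightarrow>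
   (nat \<Rightarrow> 'p sample) \<Rightarrow> 'p sample \<Rightarrow> 'p ltl option" where
  "dt_algorithm sat dt sel S = map_option
     (\<lambda>\<Pi>. tree_formula \<Pi> (dt (length \<Pi>) (training_data \<Pi> S)))
     (primitives sat sel S)"

text \<open>The loop cannot terminate if, say, only empty sub-samples are ever selected and both
  sets of examples are nonempty. Fairness
  excludes this: every pair of a positive and a negative example is eventually selected.\<close>

definition fair_selection :: "(nat \<Rightarrow> 'p sample) \<Rightarrow> 'p sample \<Rightarrow> bool" where
  "fair_selection sel = (\<lambda>(P, N).
     \<forall>\<alpha> \<in> P. \<forall>\<beta> \<in> N. \<exists>k. \<alpha> \<in> fst (sel k) \<and> \<beta> \<in> snd (sel k))"

end

theory Submission
  imports Defs
begin

text \<open>The loop of the first phase exits exactly when the primitives separate \<open>P\<close> from \<open>N\<close>, and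
  then no feature vector carries both labels, so the tree classifies every example correctly.
  The formula \<open>\<psi>\<^sub>t\<close> evaluates on a word to the label that the tree assigns to its feature vector.
  Under fair selection the finitely many pairs of examples are all selected within some number
  \<open>K\<close> of iterations, and a formula learned from a sub-sample containing a pair separates that
  pair; hence the loop exits after at most \<open>K\<close> iterations.\<close>

lemma V_TrueF [simp]: "V TrueF \<alpha>"
  by (simp add: TrueF_def Let_def)

lemma V_FalseF [simp]: "\<not> V FalseF \<alpha>"
  by (simp add: FalseF_def)

lemma V_And [simp]: "V (And \<phi> \<psi>) \<alpha> \<longleftrightarrow> V \<phi> \<alpha> \<and> V \<psi> \<alpha>"
  by (simp add: And_def)

lemma V_BigOr [simp]: "V (BigOr \<phi>s) \<alpha> \<longleftrightarrow> (\<exists>\<phi> \<in> set \<phi>s. V \<phi> \<alpha>)"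
  by (induction \<phi>s rule: BigOr.induct) auto

lemma V_BigAnd [simp]: "V (BigAnd \<phi>s) \<alpha> \<longleftrightarrow> (\<forall>\<phi> \<in> set \<phi>s. V \<phi> \<alpha>)"
  by (induction \<phi>s rule: BigAnd.induct) auto

text \<open>Each path through a node starts with the branch taken there, so only paths into the
  subtree that \<open>classify\<close> enters can agree with \<open>x\<close>.\<close>

lemma classify_iff_true_paths:
  "classify t x \<longleftrightarrow> (\<exists>\<rho> \<in> set (true_paths t). \<forall>(i, b) \<in> set \<rho>. x ! i = b)"
  by (induction t) (simp_all add: bex_Un)

lemma true_paths_features:
  "\<rho> \<in> set (true_paths t) \<Longrightarrow> (i, b) \<in> set \<rho> \<Longrightarrow> i \<in> features t"
  by (induction t arbitrary: \<rho>) (fastforce split: if_splits)+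

lemma V_tree_formula:
  assumes "features t \<subseteq> {..<length \<Pi>}"
  shows "V (tree_formula \<Pi> t) \<alpha> \<longleftrightarrow> classify t (feature_vector \<Pi> \<alpha>)"
proof -
  \<comment> \<open>Literal by literal, the conjunct for a branch holds on \<open>\<alpha>\<close>
    iff the feature vector takes that branch. The index must be in range for \<open>!\<close> to
    commute with the \<open>map\<close> in \<open>feature_vector\<close>.\<close>
  have "V (case l of (i, b) \<Rightarrow> if b then \<Pi> ! i else Neg (\<Pi> ! i)) \<alpha> \<longleftrightarrow>
      (case l of (i, b) \<Rightarrow> feature_vector \<Pi> \<alpha> ! i = b)"
    if "\<rho> \<in> set (true_paths t)" "l \<in> set \<rho>" for \<rho> l
  proof (cases l)
    case (Pair i b)
    then have "i < length \<Pi>"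
      using that true_paths_features assms by blast
    then show ?thesis
      using Pair by (simp add: feature_vector_def)
  qed
  then show ?thesis
    unfolding tree_formula_def classify_iff_true_paths V_BigOr V_BigAnd set_map bex_simps ball_simps
    by (intro bex_cong ball_cong refl)
qed

text \<open>Finiteness matters because \<open>mset_set\<close> of an infinite set is empty.\<close>

lemma in_training_data:
  assumes "finite P" "finite N"
  shows "(x, b) \<in># training_data \<Pi> (P, N) \<longleftrightarrow>
    (\<exists>\<alpha> \<in> if b then P else N. x = feature_vector \<Pi> \<alpha>)"
  using assms by (cases b) (auto simp: training_data_def)

lemma separates_not_contradictory:
  assumes "finite P" "finite N" "separates \<Pi> (P, N)"
  shows "\<not> contradictory (training_data \<Pi> (P, N))"
proof
  assume "contradictory (training_data \<Pi> (P, N))"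
  then obtain \<alpha> \<beta> where "\<alpha> \<in> P" "\<beta> \<in> N" "feature_vector \<Pi> \<alpha> = feature_vector \<Pi> \<beta>"
    using assms(1,2) by (auto simp: contradictory_def in_training_data)
  \<comment> \<open>The two vectors differ in the entry of this primitive.\<close>
  moreover from this obtain \<phi> where "\<phi> \<in> set \<Pi>" "V \<phi> \<alpha>" "\<not> V \<phi> \<beta>"
    using assms(3) by (auto simp: separates_def)
  ultimately show False
    by (auto simp: feature_vector_def)
qed

lemma consistent_tree_formula:
  assumes "is_sample S" "tree_learner dt" "separates \<Pi> S"
  shows "consistent (tree_formula \<Pi> (dt (length \<Pi>) (training_data \<Pi> S))) S"
proof -
  obtain P N where S: "S = (P, N)"
    by fastforce
  have fin: "finite P" "finite N"
    using assms(1) by (auto simp: is_sample_def S)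
  define D where "D = training_data \<Pi> S"
  define t where "t = dt (length \<Pi>) D"
  have "\<forall>(x, b) \<in># D. length x = length \<Pi>"
    by (auto simp: D_def S in_training_data[OF fin] feature_vector_def)
  moreover have "\<not> contradictory D"
    using separates_not_contradictory fin assms(3) by (simp add: D_def S)
  ultimately have t: "features t \<subseteq> {..<length \<Pi>}" "\<forall>(x, b) \<in># D. classify t x = b"
    using assms(2) by (auto simp: tree_learner_def t_def)
  have "classify t (feature_vector \<Pi> \<alpha>) = b" if "\<alpha> \<in> (if b then P else N)" for \<alpha> b
  proof -
    have "(feature_vector \<Pi> \<alpha>, b) \<in># D"
      using that by (auto simp: D_def S in_training_data[OF fin])
    then show ?thesis
      using t(2) by auto
  qed
  from this[where b = True] this[where b = False] have "consistent (tree_formula \<Pi> t) S"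
    by (simp add: consistent_def S V_tree_formula[OF t(1)])
  then show ?thesis
    by (simp add: t_def D_def)
qed

lemma primitives_separates: "primitives sat sel S = Some \<Pi> \<Longrightarrow> separates \<Pi> S"
  by (auto simp: primitives_def dest: while_option_stop)

text \<open>These are iterates of the loop body alone, ignoring the guard. Since
  \<open>add_primitive\<close> skips repetitions, the primitives are described as a set.\<close>

lemma iterate_add_primitive:
  "\<exists>\<Pi>. ((\<lambda>(k, \<Pi>). (Suc k, add_primitive (sat (sel k)) \<Pi>)) ^^ n) (0, []) = (n, \<Pi>) \<and>
     set \<Pi> = (\<lambda>k. sat (sel k)) ` {..<n}"
  by (induction n) (auto simp: add_primitive_def lessThan_Suc)

lemma is_sample_subsample: "is_sample S \<Longrightarrow> subsample S' S \<Longrightarrow> is_sample S'"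
  by (auto simp: is_sample_def subsample_def intro: finite_subset)

text \<open>Choosing one index per pair gives a function on the finite set
  \<open>P \<times> N\<close>, whose image is bounded.\<close>

lemma fair_selection_bounded:
  assumes "is_sample (P, N)" "fair_selection sel (P, N)"
  obtains K where "\<And>\<alpha> \<beta>. \<alpha> \<in> P \<Longrightarrow> \<beta> \<in> N \<Longrightarrow> \<exists>k<K. \<alpha> \<in> fst (sel k) \<and> \<beta> \<in> snd (sel k)"
proof -
  have "\<forall>p \<in> P \<times> N. \<exists>k. fst p \<in> fst (sel k) \<and> snd p \<in> snd (sel k)"
    using assms(2) by (auto simp: fair_selection_def)
  then obtain f where f: "\<forall>p \<in> P \<times> N. fst p \<in> fst (sel (f p)) \<and> snd p \<in> snd (sel (f p))"
    by metis
  have "finite (f ` (P \<times> N))"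
    using assms(1) by (simp add: is_sample_def)
  then obtain K where K: "f ` (P \<times> N) \<subseteq> {..<K}"
    by (metis finite_nat_iff_bounded)
  show thesis
  proof (rule that)
    fix \<alpha> \<beta> assume "\<alpha> \<in> P" "\<beta> \<in> N"
    then show "\<exists>k<K. \<alpha> \<in> fst (sel k) \<and> \<beta> \<in> snd (sel k)"
      using f K by (intro exI[of _ "f (\<alpha>, \<beta>)"]) (auto simp: image_subset_iff)
  qed
qed

lemma primitives_terminates:
  assumes "is_sample S" "minimal_learner sat" "\<And>k. subsample (sel k) S" "fair_selection sel S"
  shows "\<exists>\<Pi>. primitives sat sel S = Some \<Pi>"
proof -
  obtain P N where S: "S = (P, N)"
    by fastforce
  obtain K where K: "\<And>\<alpha> \<beta>. \<alpha> \<in> P \<Longrightarrow> \<beta> \<in> N \<Longrightarrow> \<exists>k<K. \<alpha> \<in> fst (sel k) \<and> \<beta> \<in> snd (sel k)"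
    using fair_selection_bounded assms(1,4) unfolding S by blast
  obtain \<Pi> where \<Pi>: "((\<lambda>(k, \<Pi>). (Suc k, add_primitive (sat (sel k)) \<Pi>)) ^^ K) (0, []) = (K, \<Pi>)"
    "set \<Pi> = (\<lambda>k. sat (sel k)) ` {..<K}"
    using iterate_add_primitive by blast
  \<comment> \<open>The guarantee of the learner covers samples only; \<open>sel k\<close> is one,
    being a sub-sample of \<open>S\<close>.\<close>
  have "consistent (sat (sel k)) (sel k)" for k
    using assms(2) is_sample_subsample[OF assms(1) assms(3)[of k]]
    by (simp only: minimal_learner_def minimal_consistent_def)
  then have "separates \<Pi> S"
    unfolding separates_def S consistent_def case_prod_beta \<Pi>(2)
    using K by simp blast
  \<comment> \<open>By definition, \<open>while_option\<close> yields \<open>Some\<close> as soon as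
    any iterate of the body falsifies the guard, and the \<open>K\<close>-th one does; the actual
    exit may come earlier.\<close>
  then have "\<exists>s. while_option (\<lambda>(k, \<Pi>). \<not> separates \<Pi> S)
      (\<lambda>(k, \<Pi>). (Suc k, add_primitive (sat (sel k)) \<Pi>)) (0, []) = Some s"
    using \<Pi>(1) unfolding while_option_def by (metis (mono_tags, lifting) case_prod_conv)
  then show ?thesis
    by (auto simp: primitives_def)
qed

theorem theorem2:
  fixes S :: "('p::finite) sample"
    and sat :: "'p sample \<Rightarrow> 'p ltl"
    and dt :: "nat \<Rightarrow> training_data \<Rightarrow> dtree"
    and sel :: "nat \<Rightarrow> 'p sample"
  assumes "is_sample S"
    and "minimal_learner sat"
    and "tree_learner dt"
    and "\<And>k. subsample (sel k) S"
  shows "(\<forall>\<psi>. dt_algorithm sat dt sel S = Some \<psi> \<longrightarrow> consistent \<psi> S) \<and>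
         (fair_selection sel S \<longrightarrow>
            (\<exists>\<psi>. dt_algorithm sat dt sel S = Some \<psi> \<and> consistent \<psi> S))"
proof (intro conjI allI impI)
  \<comment> \<open>Partial correctness serves both conjuncts; fairness then contributes only
    termination.\<close>
  have consistent: "consistent \<psi> S" if "dt_algorithm sat dt sel S = Some \<psi>" for \<psi>
    using that consistent_tree_formula[OF assms(1,3) primitives_separates]
    by (auto simp only: dt_algorithm_def map_option_eq_Some)
  then show "consistent \<psi> S" if "dt_algorithm sat dt sel S = Some \<psi>" for \<psi>
    using that .
  assume "fair_selection sel S"
  then have "\<exists>\<psi>. dt_algorithm sat dt sel S = Some \<psi>"
    using primitives_terminates[OF assms(1,2,4)] by (auto simp: dt_algorithm_def)
  with consistent show "\<exists>\<psi>. dt_algorithm sat dt sel S = Some \<psi> \<and> consistent \<psi> S"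
    by blast
qed

end
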